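(* Let $k=k(r)$ and $n=n(r)$ be sequences of integers with $k(r)\ge2$ and $n=kr$, and suppose that for some $0<\alpha<1$ we have $k=o(n^{1-\alpha})$ as $r\to\infty$. Let $\lambda=k-1$ and $\sigma_n=\frac{1}{\sqrt3}\log^{3/2}(\sqrt{n/\lambda})$. For $r\ge1$ let $\chi_n=(\log\mathbf{B}-\log\mathbf{T})/\sigma_n$, a random variable on the space of $\{0,k\}$-mappings on $n$ nodes with the uniform distribution. Then for any $\varepsilon>0$, $$\mathbb{P}_n^{\{0,k\}}(\chi_n>\varepsilon)=O\left(\frac{(\log\log n)^2\log n}{\varepsilon\,\sigma_n}\right)$$ as $r\to\infty$.
   Context: A $\{0,k\}$-mapping on $n$ nodes is a function $f:\{1,\dots,n\}\to\{1,\dots,n\}$ with $|f^{-1}(y)|\in\{0,k\}$ for every $y$. $\mathbf{T}(f)$ is the least common multiple and $\mathbf{B}(f)$ the product (with multiplicity) of the lengths of the cycles of $f$. $\mathbb{P}_n^{\{0,k\}}$ denotes probability under the uniform distribution on $\{0,k\}$-mappings on $\{1,\dots,n\}$. *)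

theory Defs
  imports "HOL-Probability.Probability" "HOL-Combinatorics.Orbits" "HOL-Library.Landau_Symbols"
begin

definition zero_k_mappings :: "nat \<Rightarrow> nat \<Rightarrow> (nat \<Rightarrow> nat) set" where
  "zero_k_mappings n k =
     {f \<in> {1..n} \<rightarrow>\<^sub>E {1..n}. \<forall>y\<in>{1..n}. card {x \<in> {1..n}. f x = y} \<in> {0, k}}"

definition cycles :: "nat \<Rightarrow> (nat \<Rightarrow> nat) \<Rightarrow> nat set set" where
  "cycles n f = {C. C \<subseteq> {1..n} \<and> cyclic_on f C}"

definition cycle_lcm :: "nat \<Rightarrow> (nat \<Rightarrow> nat) \<Rightarrow> nat" where
  "cycle_lcm n f = Lcm (card ` cycles n f)"

text \<open>The product runs over the cycles, not over the set of their lengths, so a length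
  is counted once for every cycle that has it.\<close>

definition cycle_prod :: "nat \<Rightarrow> (nat \<Rightarrow> nat) \<Rightarrow> nat" where
  "cycle_prod n f = (\<Prod>C\<in>cycles n f. card C)"

definition sigma_nk :: "nat \<Rightarrow> nat \<Rightarrow> real" where
  "sigma_nk n k = 1 / sqrt 3 * ln (sqrt (real n / (real k - 1))) powr (3/2)"

definition chi :: "nat \<Rightarrow> nat \<Rightarrow> (nat \<Rightarrow> nat) \<Rightarrow> real" where
  "chi n k f = (ln (real (cycle_prod n f)) - ln (real (cycle_lcm n f))) / sigma_nk n k"

text \<open>\<^const>\<open>pmf_of_set\<close> is only meaningful on a finite nonempty set; for \<open>n = k r\<close> with
  \<open>r \<ge> 1\<close> and \<open>k \<ge> 2\<close> this is guaranteed by the following facts.\<close>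

lemma finite_zero_k_mappings: "finite (zero_k_mappings n k)"
  unfolding zero_k_mappings_def by (rule finite_subset[OF _ finite_PiE[of "{1..n}" "\<lambda>_. {1..n}"]]) auto

lemma zero_k_mappings_nonempty:
  assumes "k \<ge> 2"
  shows "zero_k_mappings (k * r) k \<noteq> {}"
proof -
  let ?f = "restrict (\<lambda>x. (x - 1) div k + 1) {1..k * r}"
  have rng: "(x - 1) div k + 1 \<in> {1..k * r}" if "x \<in> {1..k * r}" for x
  proof -
    have "(x - 1) div k \<le> x - 1" by simp
    moreover have "1 \<le> x" "x \<le> k * r" using that by auto
    ultimately show ?thesis by (auto simp del: div_le_dividend)
  qed
  have div_iff: "m div k = q \<longleftrightarrow> k * q \<le> m \<and> m < k * q + k" for m q
    using assms dividend_less_times_div[of k m] times_div_less_eq_dividend[of k m]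
    by (metis add.commute div_nat_eqI gr0I mult.commute mult_Suc_right not_numeral_le_zero)
  have cnt: "card {x \<in> {1..k * r}. ?f x = y} \<in> {0, k}" if y: "y \<in> {1..k * r}" for y
  proof (cases "y \<le> r")
    case True
    have "{x \<in> {1..k * r}. ?f x = y} = {k * (y - 1) + 1..k * (y - 1) + k}" (is "?L = ?R")
    proof (rule set_eqI)
      fix x
      have "x \<in> ?L \<longleftrightarrow> x \<in> {1..k * r} \<and> (x - 1) div k = y - 1" using y by auto
      also have "\<dots> \<longleftrightarrow> x \<in> {1..k * r} \<and> k * (y - 1) \<le> x - 1 \<and> x - 1 < k * (y - 1) + k"
        by (simp only: div_iff)
      also have "\<dots> \<longleftrightarrow> x \<in> ?R"
      proof -
        have "k * (y - 1) + k \<le> k * r"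
          using mult_le_mono2[OF True, of k] y by (cases y) auto
        then show ?thesis by auto
      qed
      finally show "x \<in> ?L \<longleftrightarrow> x \<in> ?R" .
    qed
    then show ?thesis by simp
  next
    case False
    have "?f x \<noteq> y" if x: "x \<in> {1..k * r}" for x
    proof -
      have "(x - 1) div k < r"
        using x assms by (intro less_mult_imp_div_less) (auto simp: mult.commute)
      then show ?thesis using False x by auto
    qed
    then show ?thesis by (simp add: card_eq_0_iff)
  qed
  have "?f \<in> zero_k_mappings (k * r) k"
    unfolding zero_k_mappings_def using rng cnt by auto
  then show ?thesis by blast
qed

text \<open>A bound \<open>O(g r \<epsilon>)\<close> with a constant independent of the parameter \<open>\<epsilon> > 0\<close> is expressed by
  Landau's \<open>O\<close> for the filter \<open>sequentially \<times>\<^sub>F principal {0<..}\<close>.\<close>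

lemma bigo_uniform_iff:
  fixes f g :: "nat \<times> real \<Rightarrow> real"
  shows "f \<in> O[sequentially \<times>\<^sub>F principal {0<..}](g) \<longleftrightarrow>
    (\<exists>C>0. \<forall>\<^sub>F r in sequentially. \<forall>\<epsilon>>0. \<bar>f (r, \<epsilon>)\<bar> \<le> C * \<bar>g (r, \<epsilon>)\<bar>)"
proof -
  have *: "(\<forall>\<^sub>F x in sequentially \<times>\<^sub>F principal {0<..}. P x) \<longleftrightarrow>
      (\<forall>\<^sub>F r in sequentially. \<forall>\<epsilon>>0. P (r, \<epsilon>))" for P :: "nat \<times> real \<Rightarrow> bool"
  proof
    assume "\<forall>\<^sub>F x in sequentially \<times>\<^sub>F principal {0<..}. P x"
    then obtain A B where A: "eventually A sequentially" and B: "\<forall>\<epsilon>>0. B \<epsilon>"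
      and P: "\<And>r \<epsilon>. A r \<Longrightarrow> B \<epsilon> \<Longrightarrow> P (r, \<epsilon>)"
      unfolding eventually_prod_filter eventually_principal
      by (metis greaterThan_iff)
    from A show "\<forall>\<^sub>F r in sequentially. \<forall>\<epsilon>>0. P (r, \<epsilon>)"
      by eventually_elim (use B P in blast)
  next
    assume "\<forall>\<^sub>F r in sequentially. \<forall>\<epsilon>>0. P (r, \<epsilon>)"
    then show "\<forall>\<^sub>F x in sequentially \<times>\<^sub>F principal {0<..}. P x"
      unfolding eventually_prod_filter eventually_principal
      by (intro exI[of _ "\<lambda>r. \<forall>\<epsilon>>0. P (r, \<epsilon>)"] exI[of _ "\<lambda>\<epsilon>. \<epsilon> > 0"]) auto
  qed
  show ?thesis unfolding bigo_def by (simp add: *)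
qed

lemma bigo_uniform_imp_pointwise:
  fixes f g :: "nat \<times> real \<Rightarrow> real"
  assumes "f \<in> O[sequentially \<times>\<^sub>F principal {0<..}](g)" and "\<epsilon> > 0"
  shows "(\<lambda>r. f (r, \<epsilon>)) \<in> O[sequentially](\<lambda>r. g (r, \<epsilon>))"
proof -
  from assms(1) obtain C where
    "\<forall>\<^sub>F r in sequentially. \<forall>\<epsilon>>0. \<bar>f (r, \<epsilon>)\<bar> \<le> C * \<bar>g (r, \<epsilon>)\<bar>"
    unfolding bigo_uniform_iff by blast
  then have "\<forall>\<^sub>F r in sequentially. norm (f (r, \<epsilon>)) \<le> C * norm (g (r, \<epsilon>))"
    by eventually_elim (use assms(2) in auto)
  then show ?thesis by (rule bigoI)
qed

end

theory Submission
  imports Defs "HOL-Number_Theory.Prime_Powers"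
begin

text \<open>Let \<open>D d\<close> be the number of cycles whose length is divisible by \<open>d\<close>. Since
  \<open>ln m\<close> is the sum of the von Mangoldt function over the divisors of \<open>m\<close>,
  \<open>ln B - ln T\<close> is at most the sum of \<open>\<Lambda>(d) (D d - 1)\<^sup>+\<close> over \<open>d \<le> n\<close>. The class of
  \<open>{0,k}\<close>-mappings is closed under composition with permutations, and this symmetry alone bounds
  the expected number of \<open>m\<close>-cycles by \<open>1/m\<close> and the expected number of ordered pairs of
  distinct cycles of lengths \<open>m\<close> and \<open>l\<close> by \<open>1/(m l)\<close>. With the harmonic number \<open>h\<close> of \<open>n\<close>,
  the expectation of \<open>(D d - 1)\<^sup>+\<close> is therefore at most \<open>min (h/d) ((h/d)\<^sup>2)\<close>. Splitting the
  sum over \<open>d\<close> at about \<open>h\<^sup>2\<close> and using only \<open>\<Lambda>(d) \<le> ln d\<close> gives \<open>O(h (ln h)\<^sup>2)\<close> for the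
  expectation of \<open>ln B - ln T\<close>, and Markov's inequality concludes.\<close>

section \<open>Pointwise bound: logarithms as von Mangoldt sums\<close>

text \<open>Writing each \<open>ln (c i)\<close> as a divisor sum and swapping the sums counts
  \<open>mangoldt d\<close> once for every \<open>c i\<close> divisible by \<open>d\<close>, whereas
  the divisor sum for the Lcm contains each such \<open>d\<close> once. The truncated subtraction is
  the positive part.\<close>

lemma ln_prod_minus_ln_Lcm_le:
  fixes c :: "'a \<Rightarrow> nat"
  assumes "finite I" and c: "\<And>i. i \<in> I \<Longrightarrow> 0 < c i \<and> c i \<le> N"
  shows "ln (real (\<Prod>i\<in>I. c i)) - ln (real (Lcm (c ` I)))
    \<le> (\<Sum>d\<in>{1..N}. mangoldt d * real (card {i\<in>I. d dvd c i} - 1))"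
proof -
  define D where "D d = card {i\<in>I. d dvd c i}" for d
  have ln_sum: "ln (real m) = (\<Sum>d\<in>{1..N}. if d dvd m then mangoldt d else 0)"
    if "0 < m" "m \<le> N" for m
  proof -
    have "ln (real m) = (\<Sum>d | d dvd m. mangoldt d)"
      using mangoldt_sum[of m, where ?'a = real] that by simp
    also have "{d. d dvd m} = {d\<in>{1..N}. d dvd m}"
      using that by (auto dest: dvd_imp_le intro: Suc_leI dvd_pos_nat)
    finally show ?thesis
      by (simp only: sum.inter_filter[OF finite_atLeastAtMost])
  qed
  have "ln (real (\<Prod>i\<in>I. c i)) = (\<Sum>i\<in>I. ln (real (c i)))"
    using assms by (simp add: ln_prod)
  also have "\<dots> = (\<Sum>i\<in>I. \<Sum>d\<in>{1..N}. if d dvd c i then mangoldt d else 0)"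
    using c by (intro sum.cong refl ln_sum) auto
  also have "\<dots> = (\<Sum>d\<in>{1..N}. mangoldt d * real (D d))"
    by (subst sum.swap)
      (simp add: D_def sum.inter_filter[OF assms(1), symmetric] mult.commute)
  finally have prod: "ln (real (\<Prod>i\<in>I. c i)) = (\<Sum>d\<in>{1..N}. mangoldt d * real (D d))" .

  have Lcm0: "Lcm (c ` I) \<noteq> 0"
    using assms(1) c by (subst Lcm_0_iff) fastforce+
  have "{d\<in>{1..N}. 1 \<le> D d} \<subseteq> {d. d dvd Lcm (c ` I)}"
  proof safe
    fix d assume "1 \<le> D d"
    then have "{i\<in>I. d dvd c i} \<noteq> {}" unfolding D_def by (metis card.empty not_one_le_zero)
    then show "d dvd Lcm (c ` I)" by (auto intro: dvd_trans dvd_Lcm)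
  qed
  then have "(\<Sum>d\<in>{d\<in>{1..N}. 1 \<le> D d}. mangoldt d) \<le> (\<Sum>d | d dvd Lcm (c ` I). mangoldt d :: real)"
    using Lcm0 by (intro sum_mono2) (auto simp: mangoldt_nonneg)
  also have "\<dots> = ln (real (Lcm (c ` I)))"
    using mangoldt_sum[OF Lcm0, where ?'a = real] by simp
  finally have "(\<Sum>d\<in>{1..N}. if 1 \<le> D d then mangoldt d else 0) \<le> ln (real (Lcm (c ` I)))"
    by (simp only: sum.inter_filter[OF finite_atLeastAtMost])
  then have "ln (real (\<Prod>i\<in>I. c i)) - ln (real (Lcm (c ` I)))
    \<le> (\<Sum>d\<in>{1..N}. mangoldt d * real (D d) - (if 1 \<le> D d then mangoldt d else 0))"
    by (simp only: prod sum_subtractf diff_left_mono)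
  \<comment> \<open>Where \<open>D d\<close> is 0 both sides vanish, since \<open>0 - 1 = 0\<close>
    on naturals.\<close>
  also have "\<dots> = (\<Sum>d\<in>{1..N}. mangoldt d * real (D d - 1))"
    by (intro sum.cong refl) (auto simp: algebra_simps of_nat_diff)
  finally show ?thesis by (simp add: D_def)
qed

section \<open>Symmetry under permutations of the image points\<close>

text \<open>Lists rather than sets, because the values of \<open>f\<close> are prescribed position
  by position.\<close>

definition distinct_lists :: "nat \<Rightarrow> nat \<Rightarrow> nat list set" where
  "distinct_lists n m = {xs. length xs = m \<and> distinct xs \<and> set xs \<subseteq> {1..n}}"

lemma finite_distinct_lists: "finite (distinct_lists n m)"
  unfolding distinct_lists_def
  by (rule finite_subset[OF _ finite_lists_length_eq[of "{1..n}" m]]) auto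

text \<open>A permutation that fits the tails is followed by the transposition of \<open>p y\<close>
  and \<open>z\<close>, which fixes all targets of the tail: they differ from \<open>z\<close> and,
  \<open>p\<close> being injective, from \<open>p y\<close>.\<close>

lemma ex_permutes_map_eq:
  fixes ys zs :: "'a list"
  assumes "length ys = length zs" "distinct ys" "distinct zs" "set ys \<subseteq> A" "set zs \<subseteq> A"
  shows "\<exists>p. p permutes A \<and> map p ys = zs"
  using assms
proof (induction ys zs rule: list_induct2)
  case Nil
  then show ?case by (auto intro: permutes_id)
next
  case (Cons y ys z zs)
  then obtain p where p: "p permutes A" "map p ys = zs" by auto
  define q where "q = Transposition.transpose (p y) z \<circ> p"
  have "p y \<in> A" using p(1) Cons.prems by (simp add: permutes_in_image)
  then have "q permutes A"
    unfolding q_def using p(1) Cons.prems by (intro permutes_compose permutes_swap_id) auto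
  moreover have "q x = p x" if x: "x \<in> set ys" for x
  proof -
    have "p x \<noteq> p y" using x Cons.prems permutes_inj[OF p(1)] by (auto dest: injD)
    moreover have "p x \<in> set zs" using x p(2) by auto
    then have "p x \<noteq> z" using Cons.prems by auto
    ultimately show ?thesis by (simp add: q_def Transposition.transpose_def)
  qed
  ultimately have "q permutes A \<and> map q (y # ys) = z # zs"
    using p(2) by (auto simp: q_def)
  then show ?case by (intro exI[of _ q])
qed

text \<open>The fibre of the new map over \<open>y\<close> is the fibre of \<open>f\<close> over
  \<open>inv p y\<close>, so fibre sizes are only permuted. \<open>restrict\<close> keeps the map in
  the extensional function space.\<close>

lemma zero_k_mappings_permute:
  assumes f: "f \<in> zero_k_mappings n k" and p: "p permutes {1..n}"
  shows "restrict (p \<circ> f) {1..n} \<in> zero_k_mappings n k"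
proof -
  have fin: "f x \<in> {1..n}" if "x \<in> {1..n}" for x
    using f that by (auto simp: zero_k_mappings_def)
  have "card {x \<in> {1..n}. restrict (p \<circ> f) {1..n} x = y} \<in> {0, k}" if y: "y \<in> {1..n}" for y
  proof -
    have "{x \<in> {1..n}. restrict (p \<circ> f) {1..n} x = y} = {x \<in> {1..n}. f x = inv p y}"
      using permutes_inverses[OF p] by (intro Collect_cong) (auto simp del: atLeastAtMost_iff)
    moreover have "inv p y \<in> {1..n}"
      using y permutes_inv[OF p] by (metis permutes_in_image)
    ultimately show ?thesis using f by (auto simp: zero_k_mappings_def)
  qed
  moreover have "p (f x) \<in> {1..n}" if "x \<in> {1..n}" for x
    using fin[OF that] p by (metis permutes_in_image)
  ultimately show ?thesis by (auto simp: zero_k_mappings_def)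
qed

text \<open>Left composition with a permutation taking \<open>ys\<close> to \<open>zs\<close> is an
  injection between the two sets. As \<open>ys\<close> and \<open>zs\<close> are interchangeable,
  the counts in fact agree.\<close>

lemma card_zero_k_mappings_map_le:
  assumes "xs \<in> distinct_lists n m" "ys \<in> distinct_lists n m" "zs \<in> distinct_lists n m"
  shows "card {f \<in> zero_k_mappings n k. map f xs = ys} \<le> card {f \<in> zero_k_mappings n k. map f xs = zs}"
proof -
  from assms obtain p where p: "p permutes {1..n}" "map p ys = zs"
    using ex_permutes_map_eq[of ys zs "{1..n}"] by (auto simp: distinct_lists_def)
  let ?h = "\<lambda>f. restrict (p \<circ> f) {1..n}"
  show ?thesis
  proof (rule card_inj_on_le[of ?h])
    show "inj_on ?h {f \<in> zero_k_mappings n k. map f xs = ys}"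
    proof (rule inj_onI)
      fix f g
      assume "f \<in> {f \<in> zero_k_mappings n k. map f xs = ys}"
        and "g \<in> {f \<in> zero_k_mappings n k. map f xs = ys}" and eq: "?h f = ?h g"
      then have "f \<in> {1..n} \<rightarrow>\<^sub>E {1..n}" "g \<in> {1..n} \<rightarrow>\<^sub>E {1..n}"
        by (auto simp: zero_k_mappings_def)
      then show "f = g"
      proof (rule PiE_ext)
        fix x assume "x \<in> {1..n}"
        then have "p (f x) = p (g x)" using fun_cong[OF eq, of x] by simp
        then show "f x = g x" using permutes_inj[OF p(1)] by (auto dest: injD)
      qed
    qed
    have "map (?h f) xs = map p (map f xs)" for f
      using assms(1) by (auto simp: distinct_lists_def)
    then show "?h ` {f \<in> zero_k_mappings n k. map f xs = ys} \<subseteq> {f \<in> zero_k_mappings n k. map f xs = zs}"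
      using p zero_k_mappings_permute by auto
  qed (simp add: finite_zero_k_mappings)
qed

text \<open>Composing with permutations shows that the possible images of a fixed list of distinct
  points which again consist of distinct points are equally likely; so each has probability at
  most the reciprocal of their number.\<close>

lemma sum_card_prescribed_lists_le:
  assumes \<phi>: "\<And>xs. xs \<in> distinct_lists n m \<Longrightarrow> \<phi> xs \<in> distinct_lists n m"
  shows "(\<Sum>f\<in>zero_k_mappings n k. card {xs \<in> distinct_lists n m. map f xs = \<phi> xs})
    \<le> card (zero_k_mappings n k)"
proof (cases "distinct_lists n m = {}")
  case False
  let ?Z = "zero_k_mappings n k" and ?L = "distinct_lists n m"
  have "card ?L * card {f\<in>?Z. map f xs = \<phi> xs} \<le> card ?Z" if xs: "xs \<in> ?L" for xs
  proof -
    have "card ?L * card {f\<in>?Z. map f xs = \<phi> xs} = (\<Sum>zs\<in>?L. card {f\<in>?Z. map f xs = \<phi> xs})"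
      by simp
    also have "\<dots> \<le> (\<Sum>zs\<in>?L. card {f\<in>?Z. map f xs = zs})"
      using xs \<phi> by (intro sum_mono card_zero_k_mappings_map_le) auto
    also have "\<dots> = card (\<Union>zs\<in>?L. {f\<in>?Z. map f xs = zs})"
      by (subst card_UN_disjoint) (auto simp: finite_distinct_lists finite_zero_k_mappings)
    also have "\<dots> \<le> card ?Z"
      by (intro card_mono finite_zero_k_mappings) auto
    finally show ?thesis .
  qed
  then have "(\<Sum>xs\<in>?L. card ?L * card {f\<in>?Z. map f xs = \<phi> xs}) \<le> card ?L * card ?Z"
    using sum_bounded_above[of ?L "\<lambda>xs. card ?L * card {f\<in>?Z. map f xs = \<phi> xs}" "card ?Z"] by simp
  then have "card ?L * (\<Sum>xs\<in>?L. card {f\<in>?Z. map f xs = \<phi> xs}) \<le> card ?L * card ?Z"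
    by (simp add: sum_distrib_left)
  then have "(\<Sum>xs\<in>?L. card {f\<in>?Z. map f xs = \<phi> xs}) \<le> card ?Z"
    using False finite_distinct_lists[of n m] by (subst (asm) mult_le_cancel1) (simp add: card_gt_0_iff)
  also have "(\<Sum>xs\<in>?L. card {f\<in>?Z. map f xs = \<phi> xs}) = (\<Sum>f\<in>?Z. card {xs\<in>?L. map f xs = \<phi> xs})"
    using sum.swap[of "\<lambda>f xs. if map f xs = \<phi> xs then 1 else (0::nat)" ?L ?Z]
    by (simp add: sum.inter_filter[symmetric] finite_distinct_lists finite_zero_k_mappings)
  finally show ?thesis .
qed simp

section \<open>Cycles encoded as lists with prescribed values\<close>

text \<open>With \<open>m\<close> the length of the cycle through \<open>x\<close>, this reads that
  cycle once, starting at \<open>x\<close>.\<close>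

definition orbit_list :: "nat \<Rightarrow> (nat \<Rightarrow> nat) \<Rightarrow> nat \<Rightarrow> nat list" where
  "orbit_list m f x = map (\<lambda>i. (f ^^ i) x) [0..<m]"

text \<open>The last claim turns being a cycle into prescribed values of \<open>f\<close> on a list
  of distinct points, the form that the symmetry bound handles.\<close>

lemma orbit_list_cycle:
  assumes "cyclic_on f C" "x \<in> C"
  shows "set (orbit_list (card C) f x) = C" "distinct (orbit_list (card C) f x)"
    "length (orbit_list (card C) f x) = card C" "hd (orbit_list (card C) f x) = x"
    "map f (orbit_list (card C) f x) = rotate1 (orbit_list (card C) f x)"
proof -
  \<comment> \<open>The first return time of \<open>x\<close>, which is the length of its
    cycle.\<close>
  let ?p = "funpow_dist1 f x x"
  have C: "C = orbit f x" using assms by (simp add: cyclic_on_alldef)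
  then have x: "x \<in> orbit f x" using assms by simp
  have inj: "inj_on (\<lambda>i. (f ^^ i) x) {0..<?p}" by (rule inj_on_funpow_dist1[OF x])
  have im: "C = (\<lambda>i. (f ^^ i) x) ` {0..<?p}" using C orbit_conv_funpow_dist1[OF x] by simp
  have cardC: "card C = ?p" by (simp only: im card_image[OF inj] card_atLeastLessThan)
  then show "set (orbit_list (card C) f x) = C" "distinct (orbit_list (card C) f x)"
    "length (orbit_list (card C) f x) = card C"
    using im inj by (simp_all only: orbit_list_def set_map set_upt distinct_map distinct_upt cardC) simp_all
  show "hd (orbit_list (card C) f x) = x"
    by (simp add: cardC orbit_list_def hd_map upt_conv_Cons del: upt_Suc)
  \<comment> \<open>The return to \<open>x\<close> makes the last value the first entry of the list,
    which is what \<open>rotate1\<close> moves to the end.\<close>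
  have "(f ^^ ?p) x = x" using funpow_dist1_prop[OF x] .
  then have "map f (orbit_list ?p f x) = map (\<lambda>i. (f ^^ i) x) [1..<?p] @ [x]"
    by (simp add: orbit_list_def map_Suc_upt[symmetric] del: upt_Suc)
      (simp add: o_def)
  also have "\<dots> = rotate1 (orbit_list ?p f x)"
    by (simp add: orbit_list_def upt_conv_Cons del: upt_Suc)
  finally show "map f (orbit_list (card C) f x) = rotate1 (orbit_list (card C) f x)"
    by (simp only: cardC)
qed

lemma finite_cycles: "finite (cycles n f)"
  unfolding cycles_def by (rule finite_subset[of _ "Pow {1..n}"]) auto

lemma cyclesD:
  assumes "C \<in> cycles n f"
  shows "C \<subseteq> {1..n}" "cyclic_on f C" "finite C" "0 < card C" "card C \<le> n"
proof -
  show 1: "C \<subseteq> {1..n}" "cyclic_on f C" using assms by (auto simp: cycles_def)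
  then show 2: "finite C" by (simp add: finite_cyclic_on)
  with 1 show "0 < card C" by (auto simp: card_gt_0_iff cyclic_on_alldef)
  show "card C \<le> n" using card_mono[OF _ 1(1)] by simp
qed

lemma cycles_disjoint:
  assumes "C \<in> cycles n f" "C' \<in> cycles n f" "C \<noteq> C'"
  shows "C \<inter> C' = {}"
  using assms by (auto simp: cycles_def cyclic_on_alldef)

lemma orbit_list_in_distinct_lists:
  assumes "C \<in> cycles n f" "x \<in> C"
  shows "orbit_list (card C) f x \<in> distinct_lists n (card C)"
  using cyclesD[OF assms(1)] orbit_list_cycle[of f C x] assms(2) by (simp add: distinct_lists_def)

text \<open>Each cycle of length \<open>m\<close> yields \<open>m\<close> lists, one per starting
  point. They are all different, since the set of a list is the cycle and its head the starting
  point.\<close>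

lemma card_cycles_of_length_le:
  "m * card {C \<in> cycles n f. card C = m} \<le> card {xs \<in> distinct_lists n m. map f xs = rotate1 xs}"
proof -
  let ?S = "SIGMA C:{C \<in> cycles n f. card C = m}. C"
  have "card ?S = (\<Sum>C\<in>{C \<in> cycles n f. card C = m}. card C)"
    by (rule card_SigmaI) (auto simp: finite_cycles cyclesD)
  then have "m * card {C \<in> cycles n f. card C = m} = card ?S" by simp
  also have "\<dots> \<le> card {xs \<in> distinct_lists n m. map f xs = rotate1 xs}"
  proof (rule card_inj_on_le[of "\<lambda>(C, x). orbit_list m f x"])
    show "inj_on (\<lambda>(C, x). orbit_list m f x) ?S"
    proof (rule inj_onI, clarsimp)
      fix C x D y
      assume *: "C \<in> cycles n f" "x \<in> C" "D \<in> cycles n f" "y \<in> D" "card D = card C" "m = card C"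
        "orbit_list (card C) f x = orbit_list (card C) f y"
      have "set (orbit_list (card C) f x) = C" "hd (orbit_list (card C) f x) = x"
        using orbit_list_cycle[OF cyclesD(2)[OF *(1)] *(2)] by auto
      moreover have "set (orbit_list (card C) f y) = D" "hd (orbit_list (card C) f y) = y"
        using orbit_list_cycle[OF cyclesD(2)[OF *(3)] *(4)] *(5) by auto
      ultimately show "C = D \<and> x = y" using *(7) by metis
    qed
    show "(\<lambda>(C, x). orbit_list m f x) ` ?S \<subseteq> {xs \<in> distinct_lists n m. map f xs = rotate1 xs}"
      using orbit_list_in_distinct_lists orbit_list_cycle(5) cyclesD(2) by auto
  qed (simp add: finite_distinct_lists)
  finally show ?thesis .
qed

text \<open>Two orbit lists are concatenated. Distinct cycles are disjoint, so the result has
  \<open>m + l\<close> distinct entries, and \<open>f\<close> rotates each block separately; each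
  block determines its cycle and starting point.\<close>

lemma card_cycle_pairs_of_lengths_le:
  "m * l * card {(C, C'). C \<in> cycles n f \<and> C' \<in> cycles n f \<and> C \<noteq> C' \<and> card C = m \<and> card C' = l}
    \<le> card {xs \<in> distinct_lists n (m + l). map f xs = rotate1 (take m xs) @ rotate1 (drop m xs)}"
    (is "_ * card ?P \<le> card ?R")
proof -
  let ?S = "SIGMA p:?P. fst p \<times> snd p"
  let ?g = "\<lambda>(p, x, y). orbit_list m f x @ orbit_list l f y"
  have finP: "finite ?P"
    by (rule finite_subset[of _ "cycles n f \<times> cycles n f"]) (auto simp: finite_cycles)
  have "card ?S = (\<Sum>p\<in>?P. card (fst p \<times> snd p))"
    using finP by (intro card_SigmaI) (auto simp: cyclesD)
  also have "\<dots> = (\<Sum>p\<in>?P. m * l)"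
    by (intro sum.cong) (auto simp: card_cartesian_product)
  finally have "m * l * card ?P = card ?S" by simp
  also have "\<dots> \<le> card ?R"
  proof (rule card_inj_on_le[of ?g])
    show "inj_on ?g ?S"
    proof (rule inj_onI, clarsimp)
      fix C C' x x' D D' y y'
      assume *: "C \<in> cycles n f" "x \<in> C" "C' \<in> cycles n f" "x' \<in> C'"
        "D \<in> cycles n f" "y \<in> D" "D' \<in> cycles n f" "y' \<in> D'"
        and cards: "card D = card C" "card D' = card C'"
        and eq: "orbit_list (card C) f x @ orbit_list (card C') f x' =
                 orbit_list (card C) f y @ orbit_list (card C') f y'"
      note C = orbit_list_cycle[OF cyclesD(2)[OF *(1)] *(2)]
        and C' = orbit_list_cycle[OF cyclesD(2)[OF *(3)] *(4)]
        and D = orbit_list_cycle[OF cyclesD(2)[OF *(5)] *(6), unfolded cards]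
        and D' = orbit_list_cycle[OF cyclesD(2)[OF *(7)] *(8), unfolded cards]
      have "orbit_list (card C) f x = orbit_list (card C) f y"
        "orbit_list (card C') f x' = orbit_list (card C') f y'"
        using eq C(3) D(3) by auto
      then show "C = D \<and> C' = D' \<and> x = y \<and> x' = y'"
        using C(1,4) C'(1,4) D(1,4) D'(1,4) by metis
    qed
    show "?g ` ?S \<subseteq> ?R"
    proof clarsimp
      fix C C' x y
      assume *: "C \<in> cycles n f" "C' \<in> cycles n f" "C \<noteq> C'" "x \<in> C" "y \<in> C'"
      note C = orbit_list_cycle[OF cyclesD(2)[OF *(1)] *(4)]
        and C' = orbit_list_cycle[OF cyclesD(2)[OF *(2)] *(5)]
      show "orbit_list (card C) f x @ orbit_list (card C') f y \<in> distinct_lists n (card C + card C') \<and>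
        map f (orbit_list (card C) f x) @ map f (orbit_list (card C') f y) =
        rotate1 (take (card C) (orbit_list (card C) f x) @
            take (card C - length (orbit_list (card C) f x)) (orbit_list (card C') f y)) @
        rotate1 (drop (card C) (orbit_list (card C) f x) @
            drop (card C - length (orbit_list (card C) f x)) (orbit_list (card C') f y))"
        using C C' cycles_disjoint[OF *(1-3)] cyclesD(1)[OF *(1)] cyclesD(1)[OF *(2)]
        by (simp add: distinct_lists_def)
    qed
  qed (simp add: finite_distinct_lists)
  finally show ?thesis .
qed

section \<open>Mean numbers of cycles and of pairs of cycles\<close>

text \<open>Every \<open>m\<close>-cycle accounts for \<open>m\<close> lists, and the mean number of
  such lists is at most 1. Expectations appear here and below as sums over all mappings.\<close>

lemma sum_card_cycles_of_length_le:
  assumes "m > 0"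
  shows "(\<Sum>f\<in>zero_k_mappings n k. real (card {C \<in> cycles n f. card C = m}))
    \<le> real (card (zero_k_mappings n k)) * (1 / real m)"
proof -
  let ?Z = "zero_k_mappings n k"
  have "m * (\<Sum>f\<in>?Z. card {C \<in> cycles n f. card C = m})
      \<le> (\<Sum>f\<in>?Z. card {xs \<in> distinct_lists n m. map f xs = rotate1 xs})"
    unfolding sum_distrib_left by (intro sum_mono card_cycles_of_length_le)
  also have "\<dots> \<le> card ?Z"
    by (intro sum_card_prescribed_lists_le) (auto simp: distinct_lists_def)
  finally have "real (m * (\<Sum>f\<in>?Z. card {C \<in> cycles n f. card C = m})) \<le> real (card ?Z)"
    by (simp only: of_nat_le_iff)
  then show ?thesis using assms by (simp add: field_simps)
qed

lemma sum_card_cycle_pairs_of_lengths_le: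
  assumes "m > 0" "l > 0"
  shows "(\<Sum>f\<in>zero_k_mappings n k. real (card
      {(C, C'). C \<in> cycles n f \<and> C' \<in> cycles n f \<and> C \<noteq> C' \<and> card C = m \<and> card C' = l}))
    \<le> real (card (zero_k_mappings n k)) * (1 / real m * (1 / real l))"
proof -
  let ?Z = "zero_k_mappings n k"
  let ?P = "\<lambda>f. {(C, C'). C \<in> cycles n f \<and> C' \<in> cycles n f \<and> C \<noteq> C' \<and> card C = m \<and> card C' = l}"
  let ?\<phi> = "\<lambda>xs. rotate1 (take m xs) @ rotate1 (drop m xs)"
  have "m * l * (\<Sum>f\<in>?Z. card (?P f))
      \<le> (\<Sum>f\<in>?Z. card {xs \<in> distinct_lists n (m + l). map f xs = ?\<phi> xs})"
    unfolding sum_distrib_left by (intro sum_mono card_cycle_pairs_of_lengths_le)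
  also have "\<dots> \<le> card ?Z"
  proof (rule sum_card_prescribed_lists_le)
    fix xs :: "nat list"
    assume "xs \<in> distinct_lists n (m + l)"
    \<comment> \<open>The two blocks of a distinct list are disjoint, so rotating inside each block
      keeps the entries distinct.\<close>
    then show "?\<phi> xs \<in> distinct_lists n (m + l)"
      using set_take_disj_set_drop_if_distinct[of xs m m]
      by (auto simp: distinct_lists_def dest: in_set_takeD in_set_dropD)
  qed
  finally have "real (m * l * (\<Sum>f\<in>?Z. card (?P f))) \<le> real (card ?Z)"
    by (simp only: of_nat_le_iff)
  then show ?thesis using assms by (simp add: field_simps)
qed

text \<open>A multiple of \<open>d\<close> in the range is \<open>d * j\<close> with
  \<open>j\<close> at most \<open>n\<close>; letting \<open>j\<close> run up to \<open>n\<close> may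
  overcount but produces the harmonic number.\<close>

lemma sum_inverse_multiples_le:
  assumes "d > 0"
  shows "(\<Sum>m | m \<in> {1..n} \<and> d dvd m. 1 / real m) \<le> harm n / real d"
proof -
  have "(\<Sum>m | m \<in> {1..n} \<and> d dvd m. 1 / real m) \<le> (\<Sum>m\<in>(*) d ` {1..n}. 1 / real m)"
  proof (rule sum_mono2)
    show "{m. m \<in> {1..n} \<and> d dvd m} \<subseteq> (*) d ` {1..n}"
    proof
      fix m assume "m \<in> {m. m \<in> {1..n} \<and> d dvd m}"
      then obtain j where j: "m = d * j" "1 \<le> d * j" "d * j \<le> n" by auto
      have "j \<le> d * j" using assms by simp
      then have "j \<in> {1..n}" using j by (cases j) auto
      then show "m \<in> (*) d ` {1..n}" using j by blast
    qed
  qed auto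
  also have "\<dots> = (\<Sum>j\<in>{1..n}. 1 / real (d * j))"
    using assms by (subst sum.reindex) (auto simp: inj_on_def)
  also have "\<dots> = harm n / real d"
    by (simp add: harm_def sum_divide_distrib field_simps)
  finally show ?thesis .
qed

lemma sum_card_cycles_dvd_le:
  assumes "d > 0"
  shows "(\<Sum>f\<in>zero_k_mappings n k. real (card {C \<in> cycles n f. d dvd card C}))
    \<le> real (card (zero_k_mappings n k)) * (harm n / real d)"
proof -
  let ?Z = "zero_k_mappings n k"
  let ?M = "{m. m \<in> {1..n} \<and> d dvd m}"
  let ?c = "\<lambda>f m. card {C \<in> cycles n f. card C = m}"
  have "card {C \<in> cycles n f. d dvd card C} = (\<Sum>m\<in>?M. ?c f m)" for f
  proof -
    have "{C \<in> cycles n f. d dvd card C} = (\<Union>m\<in>?M. {C \<in> cycles n f. card C = m})"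
      using cyclesD(4,5) by (auto simp: Suc_le_eq)
    also have "card \<dots> = (\<Sum>m\<in>?M. ?c f m)"
      by (rule card_UN_disjoint) (auto simp: finite_cycles)
    finally show ?thesis .
  qed
  then have "(\<Sum>f\<in>?Z. real (card {C \<in> cycles n f. d dvd card C})) = (\<Sum>m\<in>?M. \<Sum>f\<in>?Z. real (?c f m))"
    by (subst sum.swap) simp
  also have "\<dots> \<le> (\<Sum>m\<in>?M. real (card ?Z) * (1 / real m))"
    by (intro sum_mono sum_card_cycles_of_length_le) auto
  also have "\<dots> = real (card ?Z) * (\<Sum>m\<in>?M. 1 / real m)"
    by (simp only: sum_distrib_left)
  also have "\<dots> \<le> real (card ?Z) * (harm n / real d)"
    by (intro mult_left_mono sum_inverse_multiples_le assms) auto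
  finally show ?thesis .
qed

text \<open>The positive part of \<open>D - 1\<close> is at most the number
  \<open>D * (D - 1)\<close> of ordered pairs of distinct cycles with lengths divisible by
  \<open>d\<close>. The bounds \<open>1 / (m * l)\<close> for their means then sum to a
  square.\<close>

lemma sum_card_cycles_dvd_pred_le:
  assumes "d > 0"
  shows "(\<Sum>f\<in>zero_k_mappings n k. real (card {C \<in> cycles n f. d dvd card C} - 1))
    \<le> real (card (zero_k_mappings n k)) * (harm n / real d)\<^sup>2"
proof -
  let ?Z = "zero_k_mappings n k"
  let ?M = "{m. m \<in> {1..n} \<and> d dvd m}"
  let ?P = "\<lambda>f m l. {(C, C'). C \<in> cycles n f \<and> C' \<in> cycles n f \<and> C \<noteq> C' \<and> card C = m \<and> card C' = l}"
  have fin: "finite (?P f m l)" for f m l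
    by (rule finite_subset[of _ "cycles n f \<times> cycles n f"]) (auto simp: finite_cycles)
  have "card {C \<in> cycles n f. d dvd card C} - 1 \<le> (\<Sum>p\<in>?M \<times> ?M. card (?P f (fst p) (snd p)))" for f
  proof (cases "{C \<in> cycles n f. d dvd card C} = {}")
    case False
    then obtain C where C: "C \<in> cycles n f" "d dvd card C" by blast
    let ?S = "{C \<in> cycles n f. d dvd card C}"
    \<comment> \<open>With \<open>C\<close> fixed as first component, the remaining cycles already
      supply enough pairs.\<close>
    have "card ?S - 1 = card (?S - {C})"
      using C by (simp add: finite_cycles)
    also have "\<dots> = card (Pair C ` (?S - {C}))"
      by (simp add: card_image inj_on_def)
    also have "\<dots> \<le> card (\<Union>p\<in>?M \<times> ?M. ?P f (fst p) (snd p))"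
    proof (rule card_mono)
      show "Pair C ` (?S - {C}) \<subseteq> (\<Union>p\<in>?M \<times> ?M. ?P f (fst p) (snd p))"
      proof
        fix q assume "q \<in> Pair C ` (?S - {C})"
        then obtain C' where C': "q = (C, C')" "C' \<in> cycles n f" "d dvd card C'" "C \<noteq> C'" by auto
        have "(card C, card C') \<in> ?M \<times> ?M"
          using C C' cyclesD(4,5)[OF C(1)] cyclesD(4,5)[OF C'(2)] by auto
        moreover have "q \<in> ?P f (card C) (card C')" using C C' by auto
        ultimately show "q \<in> (\<Union>p\<in>?M \<times> ?M. ?P f (fst p) (snd p))" by force
      qed
    qed (use fin in auto)
    also have "\<dots> \<le> (\<Sum>p\<in>?M \<times> ?M. card (?P f (fst p) (snd p)))"
      by (rule card_UN_le) auto
    finally show ?thesis .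
  qed (simp only: card.empty diff_0_eq_0 zero_le)
  then have "(\<Sum>f\<in>?Z. card {C \<in> cycles n f. d dvd card C} - 1)
      \<le> (\<Sum>f\<in>?Z. \<Sum>p\<in>?M \<times> ?M. card (?P f (fst p) (snd p)))"
    by (rule sum_mono)
  then have "real (\<Sum>f\<in>?Z. card {C \<in> cycles n f. d dvd card C} - 1)
      \<le> real (\<Sum>f\<in>?Z. \<Sum>p\<in>?M \<times> ?M. card (?P f (fst p) (snd p)))"
    by (simp only: of_nat_le_iff)
  then have "(\<Sum>f\<in>?Z. real (card {C \<in> cycles n f. d dvd card C} - 1))
      \<le> (\<Sum>p\<in>?M \<times> ?M. \<Sum>f\<in>?Z. real (card (?P f (fst p) (snd p))))"
    by (subst sum.swap) (simp only: of_nat_sum)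
  also have "\<dots> \<le> (\<Sum>p\<in>?M \<times> ?M. real (card ?Z) * (1 / real (fst p) * (1 / real (snd p))))"
    by (intro sum_mono sum_card_cycle_pairs_of_lengths_le) auto
  also have "\<dots> = real (card ?Z) * (\<Sum>m\<in>?M. 1 / real m)\<^sup>2"
    unfolding power2_eq_square sum_product sum.cartesian_product
    by (simp only: sum_distrib_left case_prod_unfold)
  also have "\<dots> \<le> real (card ?Z) * (harm n / real d)\<^sup>2"
    by (intro mult_left_mono power_mono sum_inverse_multiples_le assms sum_nonneg) auto
  finally show ?thesis .
qed

section \<open>Estimating the weighted sum over \<open>d\<close>\<close>

text \<open>Telescoping: the term at \<open>m + 1\<close> is at most
  \<open>2 / sqrt m - 2 / sqrt (m + 1)\<close>, a discrete form of the integral comparison.\<close>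

lemma sum_inverse_mult_sqrt_le:
  assumes "M > 0"
  shows "(\<Sum>d\<in>{M<..N}. 1 / (real d * sqrt (real d))) \<le> 2 / sqrt (real M)"
proof (cases "M \<le> N")
  case True
  have step: "1 / (real (Suc m) * sqrt (real (Suc m))) \<le> 2 / sqrt (real m) - 2 / sqrt (real (Suc m))"
    if "m > 0" for m
  proof -
    \<comment> \<open>As \<open>b * b - a * a = 1\<close>, the difference
      \<open>2 / a - 2 / b\<close> equals \<open>2 / (a * b * (a + b))\<close>, so
      \<open>a * (a + b) \<le> 2 * (b * b)\<close> suffices.\<close>
    define a b where "a = sqrt (real m)" and "b = sqrt (real (Suc m))"
    have ab: "0 < a" "a \<le> b" using that by (auto simp: a_def b_def)
    have sq: "b * b = a * a + 1" by (simp add: a_def b_def)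
    have "a * (a + b) \<le> 2 * (b * b)"
      using mult_mono[of a b "a + b" "2 * b"] ab by (simp add: algebra_simps)
    then have *: "2 / (b * (2 * (b * b))) \<le> 2 / (b * (a * (a + b)))"
      using ab by (intro divide_left_mono mult_left_mono mult_pos_pos) auto
    have diff: "(b - a) * (a + b) = 1" using sq by (simp add: algebra_simps)
    from * have "1 / (b * b * b) \<le> 2 / (a * b * (a + b))"
      by (simp add: mult_ac)
    also have "2 / (a * b * (a + b)) = 2 * ((b - a) * (a + b)) / (a * b * (a + b))" by (simp add: diff)
    also have "\<dots> = 2 * (b - a) / (a * b)" using ab by simp
    also have "\<dots> = 2 / a - 2 / b" using ab by (simp add: field_simps)
    finally show ?thesis by (simp add: a_def b_def)
  qed
  have "(\<Sum>d\<in>{M<..N}. 1 / (real d * sqrt (real d))) \<le> 2 / sqrt (real M) - 2 / sqrt (real N)"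
    using True
  proof (induction N rule: dec_induct)
    case (step m)
    have "{M<..Suc m} = insert (Suc m) {M<..m}" using step(1) by auto
    then show ?case using step assms \<open>\<And>m. m > 0 \<Longrightarrow> _\<close>[of m] by simp
  qed simp
  also have "\<dots> \<le> 2 / sqrt (real M)" by simp
  finally show ?thesis .
qed simp

text \<open>Up to the cutoff \<open>M\<close> the linear term of the minimum is used with
  \<open>mangoldt d \<le> ln M\<close>; beyond \<open>M\<close> the quadratic term is used, whose
  tail converges.\<close>

lemma sum_mangoldt_min_le:
  fixes h :: real
  assumes h: "h \<ge> 0" and M: "M > 0"
  shows "(\<Sum>d\<in>{1..N}. mangoldt d * min (h / real d) ((h / real d)\<^sup>2))
    \<le> h * ln (real M) * harm M + h\<^sup>2 * (4 / sqrt (real M))"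
proof -
  let ?t = "\<lambda>d. mangoldt d * min (h / real d) ((h / real d)\<^sup>2)"
  have nonneg: "0 \<le> ?t d" for d
    using h by (intro mult_nonneg_nonneg mangoldt_nonneg) auto
  \<comment> \<open>The range is enlarged because \<open>M\<close> may exceed
    \<open>N\<close>.\<close>
  have "(\<Sum>d\<in>{1..N}. ?t d) \<le> (\<Sum>d\<in>{1..M} \<union> {M<..N}. ?t d)"
    by (rule sum_mono2) (use nonneg in auto)
  also have "\<dots> = (\<Sum>d\<in>{1..M}. ?t d) + (\<Sum>d\<in>{M<..N}. ?t d)"
    by (rule sum.union_disjoint) auto
  also have "(\<Sum>d\<in>{1..M}. ?t d) \<le> (\<Sum>d\<in>{1..M}. h * ln (real M) * inverse (real d))"
  proof (rule sum_mono)
    fix d assume d: "d \<in> {1..M}"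
    have "mangoldt d \<le> ln (real d)" using d by (intro mangoldt_le) auto
    also have "\<dots> \<le> ln (real M)" using d by (intro ln_mono) auto
    finally have "?t d \<le> ln (real M) * (h / real d)"
      using h M by (intro mult_mono mangoldt_nonneg) auto
    then show "?t d \<le> h * ln (real M) * inverse (real d)" by (simp add: field_simps)
  qed
  also have "\<dots> = h * ln (real M) * harm M"
    by (simp only: sum_distrib_left harm_def)
  also have "(\<Sum>d\<in>{M<..N}. ?t d) \<le> (\<Sum>d\<in>{M<..N}. 2 * h\<^sup>2 * (1 / (real d * sqrt (real d))))"
  proof (rule sum_mono)
    fix d assume d: "d \<in> {M<..N}"
    have "mangoldt d \<le> ln (real d)" using d by (intro mangoldt_le) auto
    \<comment> \<open>Passing to the square root bounds the logarithm by \<open>2 * sqrt d\<close>,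
      small enough against the square of \<open>d\<close> for a summable tail.\<close>
    also have "\<dots> = 2 * ln (sqrt (real d))" using d by (simp add: ln_sqrt)
    also have "ln (sqrt (real d)) \<le> sqrt (real d)"
      using d ln_le_minus_one[of "sqrt (real d)"] by simp
    finally have "mangoldt d \<le> 2 * sqrt (real d)" by simp
    then have "?t d \<le> 2 * sqrt (real d) * (h / real d)\<^sup>2"
      by (intro mult_mono) (use h in auto)
    also have "\<dots> = 2 * h\<^sup>2 * (sqrt (real d) / (real d)\<^sup>2)"
      by (simp add: power_divide)
    also have "sqrt (real d) / (real d)\<^sup>2 = 1 / (real d * sqrt (real d))"
      using d by (simp add: field_simps power2_eq_square)
    finally show "?t d \<le> 2 * h\<^sup>2 * (1 / (real d * sqrt (real d)))" .
  qed
  also have "\<dots> \<le> 2 * h\<^sup>2 * (2 / sqrt (real M))"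
    unfolding sum_distrib_left[symmetric]
    by (intro mult_left_mono sum_inverse_mult_sqrt_le M) auto
  finally show ?thesis by (simp add: mult_ac)
qed

text \<open>The sequence \<open>harm n - ln n\<close> decreases from its value 1 at
  \<open>n = 1\<close>.\<close>

lemma harm_le_ln_plus_one:
  assumes "n > 0"
  shows "harm n \<le> ln (real n) + 1"
  using euler_mascheroni_sequence_decreasing[of 1 n] assms by (simp add: harm_def)

text \<open>The cutoff \<open>M\<close> is the square of \<open>h\<close> rounded up. This makes the
  tail at most \<open>4 * h\<close>, while \<open>ln M\<close> and \<open>harm M\<close> remain
  multiples of \<open>ln (ln n)\<close>.\<close>

lemma sum_mangoldt_min_harm_le:
  assumes "ln (ln (real n)) \<ge> 1" "n > 1"
  shows "(\<Sum>d\<in>{1..N}. mangoldt d * min (harm n / real d) ((harm n / real d)\<^sup>2))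
    \<le> 92 * ((ln (ln (real n)))\<^sup>2 * ln (real n))"
proof -
  define h x y M where "h = (harm n :: real)" and "x = ln (real n)" and "y = ln x"
    and "M = nat \<lceil>h\<^sup>2\<rceil>"
  have "0 < x" using assms(2) by (simp add: x_def)
  have y: "1 \<le> y" using assms by (simp add: x_def y_def)
  have x: "1 \<le> x" using ln_le_minus_one[OF \<open>0 < x\<close>] y by (simp add: y_def)
  have h0: "h > 0" using assms(2) unfolding h_def by (intro harm_pos) simp
  have h: "h \<le> 2 * x" using harm_le_ln_plus_one[of n] assms(2) x by (simp add: h_def x_def)
  have M: "M > 0" using h0 by (simp add: M_def)
  have hM: "h\<^sup>2 \<le> real M" unfolding M_def by (rule real_nat_ceiling_ge)
  have "real M \<le> h\<^sup>2 + 1" using h0 unfolding M_def by (simp add: of_nat_nat)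
  also have "h\<^sup>2 \<le> (2 * x)\<^sup>2" using h h0 by (intro power_mono) auto
  also have "(2 * x)\<^sup>2 + 1 \<le> 5 * x\<^sup>2"
    using one_le_power[OF x, of 2] by (simp add: power_mult_distrib)
  finally have "ln (real M) \<le> ln (5 * x\<^sup>2)" using M by (intro ln_mono) auto
  also have "\<dots> = ln 5 + 2 * y" using \<open>0 < x\<close> by (simp add: ln_mult ln_realpow y_def)
  \<comment> \<open>\<open>ln t \<le> t - 1\<close> gives \<open>ln 5 \<le> 4\<close>, and
    \<open>4 \<le> 4 * y\<close>.\<close>
  also have "\<dots> \<le> 6 * y" using ln_le_minus_one[of 5] y by simp
  finally have lnM: "ln (real M) \<le> 6 * y" .
  have lnM0: "0 \<le> ln (real M)" using M by simp
  have harmM: "harm M \<le> 7 * y" using harm_le_ln_plus_one[OF M] lnM y by simp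
  have harmM0: "0 \<le> (harm M :: real)" by (rule harm_nonneg)
  have "h \<le> sqrt (real M)" using hM h0 by (simp add: real_le_rsqrt)
  then have "h\<^sup>2 * (4 / sqrt (real M)) \<le> 4 * h"
    using h0 M by (simp add: field_simps power2_eq_square)
  moreover have "h * ln (real M) * harm M \<le> (2 * x) * (6 * y) * (7 * y)"
    using h h0 lnM lnM0 harmM harmM0 x y by (intro mult_mono) auto
  ultimately have "h * ln (real M) * harm M + h\<^sup>2 * (4 / sqrt (real M)) \<le> (2 * x) * (6 * y) * (7 * y) + 8 * x"
    using h by linarith
  also have "\<dots> \<le> (2 * x) * (6 * y) * (7 * y) + 8 * (y\<^sup>2 * x)"
    using one_le_power[OF y, of 2] \<open>0 < x\<close> by simp
  \<comment> \<open>The constant is \<open>2 * 6 * 7 + 8\<close>.\<close>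
  also have "\<dots> = 92 * (y\<^sup>2 * x)" by (simp add: power2_eq_square)
  finally have "(\<Sum>d\<in>{1..N}. mangoldt d * min (h / real d) ((h / real d)\<^sup>2)) \<le> 92 * (y\<^sup>2 * x)"
    by (rule order_trans[OF sum_mangoldt_min_le[OF less_imp_le[OF h0] M]])
  then show ?thesis by (simp only: h_def x_def y_def)
qed

section \<open>Mean of the logarithmic difference and Markov's inequality\<close>

text \<open>The pointwise bound is averaged; for each \<open>d\<close> the single-cycle and the pair
  bound both apply, hence the minimum.\<close>

lemma sum_ln_cycle_prod_minus_ln_cycle_lcm_le:
  "(\<Sum>f\<in>zero_k_mappings n k. ln (real (cycle_prod n f)) - ln (real (cycle_lcm n f)))
    \<le> real (card (zero_k_mappings n k)) *
      (\<Sum>d\<in>{1..n}. mangoldt d * min (harm n / real d) ((harm n / real d)\<^sup>2))"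
proof -
  let ?Z = "zero_k_mappings n k"
  let ?D = "\<lambda>d f. real (card {C \<in> cycles n f. d dvd card C} - 1)"
  have "(\<Sum>f\<in>?Z. ln (real (cycle_prod n f)) - ln (real (cycle_lcm n f)))
      \<le> (\<Sum>f\<in>?Z. \<Sum>d\<in>{1..n}. mangoldt d * ?D d f)"
    unfolding cycle_prod_def cycle_lcm_def
    by (intro sum_mono ln_prod_minus_ln_Lcm_le conjI finite_cycles cyclesD)
  also have "\<dots> = (\<Sum>d\<in>{1..n}. mangoldt d * (\<Sum>f\<in>?Z. ?D d f))"
    by (subst sum.swap) (simp only: sum_distrib_left)
  also have "\<dots> \<le> (\<Sum>d\<in>{1..n}. mangoldt d *
      (real (card ?Z) * min (harm n / real d) ((harm n / real d)\<^sup>2)))"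
  proof (intro sum_mono mult_left_mono mangoldt_nonneg)
    fix d assume "d \<in> {1..n}"
    then have d: "d > 0" by simp
    have "(\<Sum>f\<in>?Z. ?D d f) \<le> (\<Sum>f\<in>?Z. real (card {C \<in> cycles n f. d dvd card C}))"
      by (intro sum_mono) simp
    also have "\<dots> \<le> real (card ?Z) * (harm n / real d)" by (rule sum_card_cycles_dvd_le[OF d])
    finally show "(\<Sum>f\<in>?Z. ?D d f)
        \<le> real (card ?Z) * min (harm n / real d) ((harm n / real d)\<^sup>2)"
      using sum_card_cycles_dvd_pred_le[OF d, of n k]
      by (cases "harm n / real d \<le> (harm n / real d)\<^sup>2") (simp_all only: min_def if_True if_False)
  qed
  also have "\<dots> = real (card ?Z) *
      (\<Sum>d\<in>{1..n}. mangoldt d * min (harm n / real d) ((harm n / real d)\<^sup>2))"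
    by (simp only: sum_distrib_left mult.left_commute)
  finally show ?thesis .
qed

text \<open>Every cycle length divides the product. This supplies the nonnegativity that Markov's
  inequality needs.\<close>

lemma cycle_lcm_le_cycle_prod: "cycle_lcm n f \<le> cycle_prod n f"
proof (rule dvd_imp_le)
  show "cycle_lcm n f dvd cycle_prod n f"
    unfolding cycle_lcm_def cycle_prod_def
    by (rule Lcm_least) (auto simp: finite_cycles intro: dvd_prodI)
  show "0 < cycle_prod n f"
    unfolding cycle_prod_def using cyclesD(4) by (intro prod_pos) auto
qed

lemma cycle_lcm_pos: "0 < cycle_lcm n f"
proof -
  have "0 \<notin> card ` cycles n f" using cyclesD(4) by fastforce
  then have "cycle_lcm n f \<noteq> 0"
    unfolding cycle_lcm_def by (subst Lcm_0_iff) (auto simp: finite_cycles)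
  then show ?thesis by simp
qed

text \<open>Since \<open>k * r \<ge> k > k - 1\<close>, the logarithm is taken of a number above
  1.\<close>

lemma sigma_nk_pos:
  assumes "k \<ge> 2" "r \<ge> 1"
  shows "sigma_nk (k * r) k > 0"
proof -
  have "real k - 1 < real (k * r)"
  proof -
    have "k \<le> k * r" using assms by simp
    then have "real k \<le> real (k * r)" by (simp only: of_nat_le_iff)
    then show ?thesis by simp
  qed
  then have "1 < real (k * r) / (real k - 1)" using assms by (simp add: field_simps)
  then have "0 < ln (sqrt (real (k * r) / (real k - 1)))" by (intro ln_gt_zero) simp
  then show ?thesis unfolding sigma_nk_def by (intro mult_pos_pos) auto
qed

text \<open>Markov's inequality at level \<open>\<epsilon> * sigma_nk n k\<close>, carried out by
  counting mappings.\<close>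

lemma prob_chi_le:
  assumes k: "k \<ge> 2" and r: "r \<ge> 1" and n: "n = k * r" and \<epsilon>: "\<epsilon> > 0"
  shows "measure_pmf.prob (pmf_of_set (zero_k_mappings n k)) {f. chi n k f > \<epsilon>}
    \<le> (\<Sum>d\<in>{1..n}. mangoldt d * min (harm n / real d) ((harm n / real d)\<^sup>2)) / (\<epsilon> * sigma_nk n k)"
proof -
  let ?Z = "zero_k_mappings n k"
  let ?S = "\<Sum>d\<in>{1..n}. mangoldt d * min (harm n / real d) ((harm n / real d)\<^sup>2)"
  let ?X = "\<lambda>f. ln (real (cycle_prod n f)) - ln (real (cycle_lcm n f))"
  have \<sigma>: "sigma_nk n k > 0" using sigma_nk_pos[OF k r] n by simp
  have Z: "?Z \<noteq> {}" "finite ?Z"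
    using zero_k_mappings_nonempty[OF k] finite_zero_k_mappings n by auto
  have cZ: "real (card ?Z) > 0" using Z by (simp add: card_gt_0_iff)
  have X: "?X f \<ge> 0" for f
    using cycle_lcm_le_cycle_prod[of n f] cycle_lcm_pos[of n f] by simp
  have "real (card (?Z \<inter> {f. chi n k f > \<epsilon>})) * (\<epsilon> * sigma_nk n k)
      = (\<Sum>f\<in>?Z \<inter> {f. chi n k f > \<epsilon>}. \<epsilon> * sigma_nk n k)" by simp
  also have "\<dots> \<le> (\<Sum>f\<in>?Z \<inter> {f. chi n k f > \<epsilon>}. ?X f)"
    using \<sigma> by (intro sum_mono) (auto simp: chi_def field_simps)
  also have "\<dots> \<le> (\<Sum>f\<in>?Z. ?X f)"
    using Z X by (intro sum_mono2) auto
  also have "\<dots> \<le> real (card ?Z) * ?S" by (rule sum_ln_cycle_prod_minus_ln_cycle_lcm_le)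
  finally show ?thesis
    using cZ \<sigma> \<epsilon> Z by (simp add: measure_pmf_of_set field_simps)
qed

text \<open>The Markov bound and the target contain \<open>\<epsilon>\<close> in the same factor of
  the denominator, so the constant 92 serves all \<open>\<epsilon> > 0\<close> at once.\<close>

theorem theorem5p4:
  fixes k n :: "nat \<Rightarrow> nat" and \<alpha> :: real
  assumes "\<And>r. r \<ge> 1 \<Longrightarrow> k r \<ge> 2"
    and "\<And>r. r \<ge> 1 \<Longrightarrow> n r = k r * r"
    and "0 < \<alpha>" and "\<alpha> < 1"
    and "(\<lambda>r. real (k r)) \<in> o[sequentially](\<lambda>r. real (n r) powr (1 - \<alpha>))"
  shows "(\<lambda>(r, \<epsilon>). measure_pmf.prob (pmf_of_set (zero_k_mappings (n r) (k r)))
                       {f. chi (n r) (k r) f > \<epsilon>})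
         \<in> O[sequentially \<times>\<^sub>F principal {0<..}](\<lambda>(r, \<epsilon>).
              (ln (ln (real (n r))))\<^sup>2 * ln (real (n r)) / (\<epsilon> * sigma_nk (n r) (k r)))"
  unfolding bigo_uniform_iff
proof (intro exI[of _ 92] conjI)
  \<comment> \<open>As \<open>r \<le> n r\<close>, this threshold forces
    \<open>ln (ln (n r)) \<ge> 1\<close>, which the sum estimate requires.\<close>
  have "\<forall>\<^sub>F r in sequentially. exp (exp 1) \<le> real r"
    using filterlim_real_sequentially by (simp add: filterlim_at_top)
  then show "\<forall>\<^sub>F r in sequentially. \<forall>\<epsilon>>0.
    \<bar>case (r, \<epsilon>) of (r, \<epsilon>) \<Rightarrow> measure_pmf.prob (pmf_of_set (zero_k_mappings (n r) (k r)))
                       {f. chi (n r) (k r) f > \<epsilon>}\<bar>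
    \<le> 92 * \<bar>case (r, \<epsilon>) of (r, \<epsilon>) \<Rightarrow>
      (ln (ln (real (n r))))\<^sup>2 * ln (real (n r)) / (\<epsilon> * sigma_nk (n r) (k r))\<bar>"
    using eventually_ge_at_top[of 1]
  proof eventually_elim
    case (elim r)
    have k: "k r \<ge> 2" and n: "n r = k r * r" using assms(1,2) elim by auto
    have "r \<le> n r" using k n by simp
    then have "exp (exp 1) \<le> real (n r)" using elim by linarith
    then have "exp 1 \<le> ln (real (n r))" using less_le_trans[OF exp_gt_zero] by (subst ln_ge_iff) blast+
    then have lnln: "1 \<le> ln (ln (real (n r)))" using less_le_trans[OF exp_gt_zero] by (subst ln_ge_iff) blast+
    have n1: "n r > 1"
    proof -
      have "1 < exp (exp (1::real))" by simp
      then show ?thesis using \<open>exp (exp 1) \<le> real (n r)\<close> by linarith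
    qed
    have \<sigma>: "sigma_nk (n r) (k r) > 0" using sigma_nk_pos[OF k elim(2)] n by simp
    show ?case
    proof (intro allI impI)
      fix \<epsilon> :: real assume \<epsilon>: "\<epsilon> > 0"
      let ?R = "(ln (ln (real (n r))))\<^sup>2 * ln (real (n r))"
      have "measure_pmf.prob (pmf_of_set (zero_k_mappings (n r) (k r))) {f. chi (n r) (k r) f > \<epsilon>}
          \<le> 92 * ?R / (\<epsilon> * sigma_nk (n r) (k r))"
        using \<epsilon> \<sigma> by (intro order_trans[OF prob_chi_le[OF k elim(2) n \<epsilon>]] divide_right_mono
          sum_mangoldt_min_harm_le lnln n1) auto
      also have "\<dots> = 92 * \<bar>?R / (\<epsilon> * sigma_nk (n r) (k r))\<bar>"
        using \<epsilon> \<sigma> n1 by (simp add: abs_mult)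
      finally show "\<bar>case (r, \<epsilon>) of (r, \<epsilon>) \<Rightarrow> measure_pmf.prob (pmf_of_set (zero_k_mappings (n r) (k r)))
                       {f. chi (n r) (k r) f > \<epsilon>}\<bar>
        \<le> 92 * \<bar>case (r, \<epsilon>) of (r, \<epsilon>) \<Rightarrow>
          (ln (ln (real (n r))))\<^sup>2 * ln (real (n r)) / (\<epsilon> * sigma_nk (n r) (k r))\<bar>"
        by (simp add: measure_nonneg)
    qed
  qed
qed simp

end
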